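(* Let $E$ be a Banach space and let $(E_n)_{n\in\mathbb N}$ be a sequence of subspaces of $E$ with $\dim E_n=n$, $E_n\subseteq E_{n+1}$ for all $n\ge1$ and $E=\overline{\bigcup_{n=1}^\infty E_n}$. Moreover, assume that for all $n\ge1$ there are projections $P_n:E\to E_n\subseteq E$ with $\sup_{n\ge1}\|P_n\|<\infty$. Let $j_n:E_n\to E_{n+1}$ be the canonical inclusion maps. Then $(E_n,j_n)_{n\in\mathbb N}$ is a Little G.T. flag if and only if $E$ is a Hilbert–Schmidt space.
   Context: Banach spaces are real. An element of $X\otimes X$ is nonnegative ($\ge 0$) if it is in the convex hull of $\{x\otimes x:x\in X\}$. For a finite-dimensional Banach space $X$, $\gamma(X)$ is the infimum of all $c$ such that $\langle A,B\rangle\le c\|A\|_{X\check\otimes X}\|B\|_{X^*\check\otimes X^*}$ for all nonnegative $A\in X\otimes X$ and nonnegative $B\in X^*\otimes X^*$, where $\check\otimes$ is the injective tensor product and $\langle x\otimes y,x^*\otimes y^*\rangle=x^*(x)y^*(y)$. Little G.T. flag: a sequence $(E_n,j_n)_{n\in\mathbb N}$ with $E_n$ finite-dimensional Banach spaces, $\dim E_n=n$, $j_n:E_n\to E_{n+1}$ isometries, and $\sup_n\gamma(E_n)<\infty$. Hilbert–Schmidt space: a Banach space $E$ such that every bounded linear operator $u:E\to\ell_2$ is $2$-summing (equivalently, the identity $\Pi_2(E,\ell_2)\to B(E,\ell_2)$ is an isomorphism). *)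

theory Defs
  imports "HOL-Analysis.Analysis" "HOL-Library.Function_Algebras"
begin

section \<open>Functions into a vector space\<close>

instantiation "fun" :: (type, real_vector) real_vector
begin

definition scaleR_fun :: "real \<Rightarrow> ('a \<Rightarrow> 'b) \<Rightarrow> 'a \<Rightarrow> 'b"
  where "scaleR_fun c f = (\<lambda>x. c *\<^sub>R f x)"

instance
  by standard (simp_all add: scaleR_fun_def fun_eq_iff scaleR_add_right scaleR_add_left)

end

section \<open>Normed spaces on a carrier, and their duals\<close>

text \<open>
  The members of a flag have different dimensions, so they cannot all be types.  An abstract
  normed space is a linear subspace \<open>X\<close> of some real vector space together with a function \<open>N\<close>
  that is a norm on \<open>X\<close>; the values of \<open>N\<close> outside \<open>X\<close> play no role.
\<close>

definition normed_space_on :: "'a::real_vector set \<Rightarrow> ('a \<Rightarrow> real) \<Rightarrow> bool" where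
  "normed_space_on X N \<longleftrightarrow>
     subspace X \<and>
     (\<forall>x\<in>X. 0 \<le> N x \<and> (N x = 0 \<longleftrightarrow> x = 0)) \<and>
     (\<forall>x\<in>X. \<forall>c. N (c *\<^sub>R x) = \<bar>c\<bar> * N x) \<and>
     (\<forall>x\<in>X. \<forall>y\<in>X. N (x + y) \<le> N x + N y)"

definition linear_on :: "'a::real_vector set \<Rightarrow> ('a \<Rightarrow> 'b::real_vector) \<Rightarrow> bool" where
  "linear_on X f \<longleftrightarrow>
     (\<forall>x\<in>X. \<forall>y\<in>X. f (x + y) = f x + f y) \<and> (\<forall>x\<in>X. \<forall>c. f (c *\<^sub>R x) = c *\<^sub>R f x)"

text \<open>
  A functional on \<open>X\<close> is represented by its extension by zero, so that distinct members of
  \<open>dual X N\<close> are distinct functionals on \<open>X\<close>.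
\<close>

definition dual :: "'a::real_vector set \<Rightarrow> ('a \<Rightarrow> real) \<Rightarrow> ('a \<Rightarrow> real) set" where
  "dual X N = {f. linear_on X f \<and> (\<exists>C. \<forall>x\<in>X. \<bar>f x\<bar> \<le> C * N x) \<and> (\<forall>x. x \<notin> X \<longrightarrow> f x = 0)}"

definition dual_norm :: "'a::real_vector set \<Rightarrow> ('a \<Rightarrow> real) \<Rightarrow> ('a \<Rightarrow> real) \<Rightarrow> real" where
  "dual_norm X N f = (SUP x\<in>{x\<in>X. N x \<le> 1}. \<bar>f x\<bar>)"

definition dual_ball :: "'a::real_vector set \<Rightarrow> ('a \<Rightarrow> real) \<Rightarrow> ('a \<Rightarrow> real) set" where
  "dual_ball X N = {f \<in> dual X N. dual_norm X N f \<le> 1}"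

section \<open>Algebraic tensor products\<close>

text \<open>
  \<open>x \<otimes> y\<close> is the evaluation \<open>\<phi> \<mapsto> \<phi>(x, y)\<close> on the bilinear forms \<open>\<phi>\<close> on \<open>X \<times> Y\<close>, and the algebraic
  tensor product of \<open>X\<close> and \<open>Y\<close> is the span of these evaluations.  For \<open>t\<close> in the tensor product and
  \<open>\<phi>\<close> bilinear, \<open>t \<phi>\<close> is thus the value at \<open>t\<close> of the linear form induced by \<open>\<phi>\<close>.
\<close>

type_synonym ('a, 'b) tensor = "('a \<Rightarrow> 'b \<Rightarrow> real) \<Rightarrow> real"

definition bilinear_on ::
    "'a::real_vector set \<Rightarrow> 'b::real_vector set \<Rightarrow> ('a \<Rightarrow> 'b \<Rightarrow> real) \<Rightarrow> bool" where
  "bilinear_on X Y \<phi> \<longleftrightarrow> (\<forall>x\<in>X. linear_on Y (\<phi> x)) \<and> (\<forall>y\<in>Y. linear_on X (\<lambda>x. \<phi> x y))"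

definition elem_tensor ::
    "'a::real_vector set \<Rightarrow> 'b::real_vector set \<Rightarrow> 'a \<Rightarrow> 'b \<Rightarrow> ('a, 'b) tensor" where
  "elem_tensor X Y x y = (\<lambda>\<phi>. if bilinear_on X Y \<phi> then \<phi> x y else 0)"

definition tensor_product ::
    "'a::real_vector set \<Rightarrow> 'b::real_vector set \<Rightarrow> ('a, 'b) tensor set" where
  "tensor_product X Y = span {elem_tensor X Y x y | x y. x \<in> X \<and> y \<in> Y}"

definition nonneg_tensors :: "'a::real_vector set \<Rightarrow> ('a, 'a) tensor set" where
  "nonneg_tensors X = {t \<in> tensor_product X X. t \<in> convex hull {elem_tensor X X x x | x. x \<in> X}}"

text \<open>
  The injective norm of \<open>t\<close> is the supremum of \<open>\<bar>(f \<otimes> g)(t)\<bar>\<close> over the unit balls of the two duals.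
\<close>

definition injective_norm ::
    "'a::real_vector set \<Rightarrow> ('a \<Rightarrow> real) \<Rightarrow> 'b::real_vector set \<Rightarrow> ('b \<Rightarrow> real)
      \<Rightarrow> ('a, 'b) tensor \<Rightarrow> real" where
  "injective_norm X N Y M t =
     (SUP (f, g) \<in> dual_ball X N \<times> dual_ball Y M. \<bar>t (\<lambda>x y. f x * g y)\<bar>)"

text \<open>
  The pairing of \<open>X \<otimes> X\<close> with \<open>X\<^sup>* \<otimes> X\<^sup>*\<close>: the bilinear form \<open>(f, g) \<mapsto> (f \<otimes> g)(A)\<close> on
  \<open>X\<^sup>* \<times> X\<^sup>*\<close> is evaluated at \<open>B\<close>.
\<close>

definition tensor_pairing ::
    "('a::real_vector, 'a) tensor \<Rightarrow> ('a \<Rightarrow> real, 'a \<Rightarrow> real) tensor \<Rightarrow> real" where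
  "tensor_pairing A B = B (\<lambda>f g. A (\<lambda>x y. f x * g y))"

lemma tensor_pairing_elem_tensor:
  assumes "x \<in> X" "y \<in> X" "f \<in> dual X N" "g \<in> dual X N"
  shows "tensor_pairing (elem_tensor X X x y) (elem_tensor (dual X N) (dual X N) f g) = f x * g y"
proof -
  have *: "bilinear_on X X (\<lambda>x y. f x * g y)" if "f \<in> dual X N" "g \<in> dual X N" for f g
    using that by (auto simp: bilinear_on_def linear_on_def dual_def algebra_simps)
  have add: "f + g \<in> dual X N" if "f \<in> dual X N" "g \<in> dual X N" for f g
  proof -
    from that obtain C D where "\<forall>x\<in>X. \<bar>f x\<bar> \<le> C * N x" "\<forall>x\<in>X. \<bar>g x\<bar> \<le> D * N x"
      by (auto simp: dual_def)
    then have "\<forall>x\<in>X. \<bar>(f + g) x\<bar> \<le> (C + D) * N x"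
      by (auto simp: distrib_right intro!: order_trans[OF abs_triangle_ineq] add_mono)
    then have "\<exists>C. \<forall>x\<in>X. \<bar>(f + g) x\<bar> \<le> C * N x" ..
    with that show ?thesis
      by (simp add: dual_def linear_on_def distrib_left)
  qed
  have scale: "c *\<^sub>R f \<in> dual X N" if "f \<in> dual X N" for c f
  proof -
    from that obtain C where "\<forall>x\<in>X. \<bar>f x\<bar> \<le> C * N x"
      by (auto simp: dual_def)
    then have "\<forall>x\<in>X. \<bar>(c *\<^sub>R f) x\<bar> \<le> (\<bar>c\<bar> * C) * N x"
      by (auto simp: scaleR_fun_def abs_mult mult.assoc intro: mult_left_mono)
    then have "\<exists>C. \<forall>x\<in>X. \<bar>(c *\<^sub>R f) x\<bar> \<le> C * N x" ..
    with that show ?thesis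
      by (simp add: dual_def linear_on_def scaleR_fun_def distrib_left)
  qed
  have "elem_tensor X X x y (\<lambda>x y. f x * g y) = f x * g y"
    if "f \<in> dual X N" "g \<in> dual X N" for f g
    using *[OF that] by (simp add: elem_tensor_def)
  moreover from this
  have "bilinear_on (dual X N) (dual X N) (\<lambda>f g. elem_tensor X X x y (\<lambda>x y. f x * g y))"
    unfolding bilinear_on_def linear_on_def
    by (simp only: add scale simp_thms ball_simps cong: ball_cong)
      (simp add: scaleR_fun_def distrib_left distrib_right)
  ultimately show ?thesis
    using assms(3,4) by (simp add: tensor_pairing_def elem_tensor_def[of "dual X N"])
qed

section \<open>Little G.T. flags\<close>

text \<open>The infimum is taken in the extended reals, where it always exists.\<close>

definition gamma_const :: "'a::real_vector set \<Rightarrow> ('a \<Rightarrow> real) \<Rightarrow> ereal" where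
  "gamma_const X N =
     Inf {ereal c | c :: real.
       \<forall>A \<in> nonneg_tensors X. \<forall>B \<in> nonneg_tensors (dual X N).
         tensor_pairing A B
           \<le> c * injective_norm X N X N A
               * injective_norm (dual X N) (dual_norm X N) (dual X N) (dual_norm X N) B}"

definition isometry_on ::
    "'a::real_vector set \<Rightarrow> ('a \<Rightarrow> real) \<Rightarrow> 'b::real_vector set \<Rightarrow> ('b \<Rightarrow> real) \<Rightarrow> ('a \<Rightarrow> 'b) \<Rightarrow> bool"
  where
  "isometry_on X N Y M j \<longleftrightarrow> linear_on X j \<and> j ` X \<subseteq> Y \<and> (\<forall>x\<in>X. M (j x) = N x)"

text \<open>
  The spaces are indexed by \<open>n \<ge> 1\<close>; the entries at index \<open>0\<close> are ignored.  Since \<open>dim\<close> is \<open>0\<close> for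
  infinite-dimensional subspaces, \<open>dim (E n) = n\<close> with \<open>n \<ge> 1\<close> entails that \<open>E n\<close> is
  finite-dimensional, and hence complete.
\<close>

definition little_GT_flag ::
    "(nat \<Rightarrow> 'a::real_vector set) \<Rightarrow> (nat \<Rightarrow> 'a \<Rightarrow> real) \<Rightarrow> (nat \<Rightarrow> 'a \<Rightarrow> 'a) \<Rightarrow> bool" where
  "little_GT_flag E N j \<longleftrightarrow>
     (\<forall>n\<ge>1. normed_space_on (E n) (N n) \<and> dim (E n) = n) \<and>
     (\<forall>n\<ge>1. isometry_on (E n) (N n) (E (Suc n)) (N (Suc n)) (j n)) \<and>
     (SUP n\<in>{1..}. gamma_const (E n) (N n)) < \<infinity>"

section \<open>The real Hilbert space of square-summable sequences\<close>

typedef ell2 = "{x :: nat \<Rightarrow> real. summable (\<lambda>i. (x i)\<^sup>2)}"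
  morphisms ell2_nth Abs_ell2
  by (rule exI[of _ "\<lambda>_. 0"]) simp

setup_lifting type_definition_ell2

lemma ell2_add:
  fixes x y :: "nat \<Rightarrow> real"
  assumes x: "summable (\<lambda>i. (x i)\<^sup>2)" and y: "summable (\<lambda>i. (y i)\<^sup>2)"
  shows "summable (\<lambda>i. (x i + y i)\<^sup>2)"
    and "sqrt (\<Sum>i. (x i + y i)\<^sup>2) \<le> sqrt (\<Sum>i. (x i)\<^sup>2) + sqrt (\<Sum>i. (y i)\<^sup>2)"
proof -
  let ?S = "sqrt (\<Sum>i. (x i)\<^sup>2) + sqrt (\<Sum>i. (y i)\<^sup>2)"
  have part: "(\<Sum>i<n. (x i + y i)\<^sup>2) \<le> ?S\<^sup>2" for n
  proof -
    have "sqrt (\<Sum>i<n. (x i + y i)\<^sup>2) \<le> sqrt (\<Sum>i<n. (x i)\<^sup>2) + sqrt (\<Sum>i<n. (y i)\<^sup>2)"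
      using L2_set_triangle_ineq[of x y "{..<n}"] by (simp add: L2_set_def)
    also have "\<dots> \<le> ?S"
      using x y by (intro add_mono real_sqrt_le_mono sum_le_suminf) auto
    finally show ?thesis
      by (rule sqrt_le_D)
  qed
  show sm: "summable (\<lambda>i. (x i + y i)\<^sup>2)"
    by (rule bounded_imp_summable[where B = "?S\<^sup>2"])
      (simp_all only: part lessThan_Suc_atMost[symmetric] zero_le_power2)
  have "(\<Sum>i. (x i + y i)\<^sup>2) \<le> ?S\<^sup>2"
    by (rule suminf_le_const[OF sm part])
  then show "sqrt (\<Sum>i. (x i + y i)\<^sup>2) \<le> ?S"
    by (intro real_le_lsqrt add_nonneg_nonneg real_sqrt_ge_zero suminf_nonneg x y) auto
qed

instantiation ell2 :: real_normed_vector
begin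

lift_definition zero_ell2 :: ell2 is "\<lambda>_. 0" by simp

lift_definition plus_ell2 :: "ell2 \<Rightarrow> ell2 \<Rightarrow> ell2" is "\<lambda>x y i. x i + y i"
  by (rule ell2_add(1))

lift_definition uminus_ell2 :: "ell2 \<Rightarrow> ell2" is "\<lambda>x i. - x i" by simp

lift_definition minus_ell2 :: "ell2 \<Rightarrow> ell2 \<Rightarrow> ell2" is "\<lambda>x y i. x i - y i"
  using ell2_add(1)[of _ "\<lambda>i. - _ i"] by simp

lift_definition scaleR_ell2 :: "real \<Rightarrow> ell2 \<Rightarrow> ell2" is "\<lambda>c x i. c * x i"
  by (simp add: power_mult_distrib summable_mult)

lift_definition norm_ell2 :: "ell2 \<Rightarrow> real" is "\<lambda>x. sqrt (\<Sum>i. (x i)\<^sup>2)" .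

definition sgn_ell2 :: "ell2 \<Rightarrow> ell2" where "sgn_ell2 x = inverse (norm x) *\<^sub>R x"

definition dist_ell2 :: "ell2 \<Rightarrow> ell2 \<Rightarrow> real" where "dist_ell2 x y = norm (x - y)"

definition uniformity_ell2 :: "(ell2 \<times> ell2) filter" where
  "uniformity_ell2 = (INF e\<in>{0<..}. principal {(x, y). dist x y < e})"

definition open_ell2 :: "ell2 set \<Rightarrow> bool" where
  "open_ell2 S = (\<forall>x\<in>S. \<forall>\<^sub>F (x', y) in uniformity. x' = x \<longrightarrow> y \<in> S)"

instance
proof
  fix x y :: ell2 and a b :: real
  show "norm x = 0 \<longleftrightarrow> x = 0"
    by transfer (auto simp: suminf_eq_zero_iff)
  show "norm (x + y) \<le> norm x + norm y"
    by transfer (rule ell2_add(2))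
  show "norm (a *\<^sub>R x) = \<bar>a\<bar> * norm x"
    by transfer (simp add: power_mult_distrib suminf_mult real_sqrt_mult)
qed (rule sgn_ell2_def dist_ell2_def uniformity_ell2_def open_ell2_def
     | (transfer, simp add: algebra_simps))+

end

section \<open>Hilbert-Schmidt spaces\<close>

definition two_summing :: "('a::real_normed_vector \<Rightarrow> 'b::real_normed_vector) \<Rightarrow> bool" where
  "two_summing u \<longleftrightarrow> linear u \<and>
     (\<exists>C::real. \<forall>(n::nat) (x :: nat \<Rightarrow> 'a).
        sqrt (\<Sum>i<n. (norm (u (x i)))\<^sup>2)
          \<le> C * sqrt (SUP f \<in> {f :: 'a \<Rightarrow>\<^sub>L real. norm f \<le> 1}. \<Sum>i<n. (blinfun_apply f (x i))\<^sup>2))"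

definition hilbert_schmidt_space :: "'a::banach itself \<Rightarrow> bool" where
  "hilbert_schmidt_space _ \<longleftrightarrow> (\<forall>u :: 'a \<Rightarrow> ell2. bounded_linear u \<longrightarrow> two_summing u)"

end

theory Submission
  imports Defs
begin

text \<open>
  A nonnegative tensor is a sum of squares \<open>\<Sum>x\<^sub>i \<otimes> x\<^sub>i\<close>, and its injective norm
  is the supremum of \<open>\<Sum>f(x\<^sub>i)\<^sup>2\<close> over the dual ball.  So \<open>\<gamma>(X) \<le> c\<close> says that a
  finite-rank operator \<open>u = (f\<^sub>j)\<^sub>j\<close> from \<open>X\<close> to \<open>\<ell>\<^sub>2\<close> satisfies
  \<open>\<Sum>\<^sub>i \<parallel>u x\<^sub>i\<parallel>\<^sup>2 \<le> c \<parallel>u\<parallel>\<^sup>2\<close> whenever the weak 2-norm of \<open>(x\<^sub>i)\<close> is at most 1: \<open>\<gamma>(X)\<close> is the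
  best constant in \<open>\<pi>\<^sub>2(u)\<^sup>2 \<le> c \<parallel>u\<parallel>\<^sup>2\<close>.  The theorem therefore
  compares a quantitative statement about all \<open>E\<^sub>n\<close> with a qualitative one about \<open>E\<close>.

  From the flag to the space (\<open>two_summing_if_gamma_const_bounded\<close>): given \<open>u\<close> on \<open>E\<close> and vectors
  \<open>x\<^sub>i\<close>, apply the bound for \<open>E\<^sub>n\<close> to the vectors \<open>P\<^sub>n x\<^sub>i\<close> and to finitely many coordinates of \<open>u\<close>.
  Composing functionals on \<open>E\<^sub>n\<close> with \<open>P\<^sub>n\<close> shows that the weak 2-norm grows by at most
  \<open>sup \<parallel>P\<^sub>n\<parallel>\<close>, so that functionals never have to be extended by Hahn-Banach.  Then let first the
  number of coordinates and afterwards \<open>n\<close> tend to infinity, using \<open>P\<^sub>n x \<longlonglongrightarrow> x\<close>.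

  From the space to the flag (\<open>gamma_const_bounded_if_hilbert_schmidt_space\<close>): a uniform constant
  has to be extracted from the mere fact that every operator is 2-summing.  In place of a closed
  graph argument on the space of 2-summing operators, a gliding hump is used.  If
  the \<open>\<gamma>(E\<^sub>n)\<close> were unbounded, there would be operators \<open>u\<^sub>k\<close> of norm at most 1 on some \<open>E\<^bsub>n(k)\<^esub>\<close>
  with \<open>\<pi>\<^sub>2(u\<^sub>k)\<^sup>2 > 8\<^sup>k\<close>; the orthogonal sum of the operators \<open>2\<^bsup>-k\<^esup> u\<^sub>k P\<^bsub>n(k)\<^esub>\<close> would be a bounded
  operator on \<open>E\<close> that is not 2-summing.
\<close>

section \<open>Nonnegative tensors as sums of squares\<close>

definition square_sum :: "'a::real_vector set \<Rightarrow> 'a list \<Rightarrow> ('a, 'a) tensor" where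
  "square_sum X xs = (\<Sum>x\<leftarrow>xs. elem_tensor X X x x)"

lemma square_sum_Nil: "square_sum X [] = 0"
  by (simp add: square_sum_def)

lemma square_sum_Cons: "square_sum X (x # xs) = elem_tensor X X x x + square_sum X xs"
  by (simp add: square_sum_def)

lemma square_sum_append: "square_sum X (xs @ ys) = square_sum X xs + square_sum X ys"
  by (simp add: square_sum_def)

lemma square_sum_apply:
  assumes "bilinear_on X X \<phi>"
  shows "square_sum X xs \<phi> = (\<Sum>x\<leftarrow>xs. \<phi> x x)"
  using assms by (induction xs) (simp_all add: square_sum_def elem_tensor_def)

lemma elem_tensor_scaleR:
  assumes "x \<in> X" "subspace X"
  shows "elem_tensor X X (c *\<^sub>R x) (c *\<^sub>R x) = (c * c) *\<^sub>R elem_tensor X X x x"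
proof
  fix \<phi> :: "'a \<Rightarrow> 'a \<Rightarrow> real"
  show "elem_tensor X X (c *\<^sub>R x) (c *\<^sub>R x) \<phi> = ((c * c) *\<^sub>R elem_tensor X X x x) \<phi>"
    using assms subspace_scale[of X x c]
    by (auto simp: elem_tensor_def scaleR_fun_def bilinear_on_def linear_on_def)
qed

lemma square_sum_scaleR:
  assumes "set xs \<subseteq> X" "subspace X" "0 \<le> c"
  shows "c *\<^sub>R square_sum X xs = square_sum X (map (\<lambda>x. sqrt c *\<^sub>R x) xs)"
  using assms(1)
proof (induction xs)
  case (Cons x xs)
  then have "elem_tensor X X (sqrt c *\<^sub>R x) (sqrt c *\<^sub>R x) = c *\<^sub>R elem_tensor X X x x"
    using elem_tensor_scaleR[of x X "sqrt c"] assms(2,3) by simp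
  moreover have "c *\<^sub>R square_sum X xs = square_sum X (map (\<lambda>x. sqrt c *\<^sub>R x) xs)"
    using Cons by simp
  ultimately show ?case
    by (simp only: square_sum_Cons list.map scaleR_add_right)
qed (simp only: square_sum_Nil list.map scaleR_zero_right)

text \<open>
  Both sets are convex cones generated by the squares \<open>x \<otimes> x\<close>, because \<open>c (x \<otimes> x) = y \<otimes> y\<close> with
  \<open>y = \<surd>c x\<close> absorbs every weight, including those of a convex combination.
\<close>

lemma nonneg_tensors_eq_square_sums:
  assumes X: "subspace X"
  shows "nonneg_tensors X = square_sum X ` {xs. set xs \<subseteq> X}"
proof
  let ?S = "{elem_tensor X X x x | x. x \<in> X}"
  let ?T = "square_sum X ` {xs. set xs \<subseteq> X}"
  have "convex ?T \<and> cone ?T"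
    unfolding convex_cone
  proof (intro conjI ballI allI impI)
    fix s t assume "s \<in> ?T" "t \<in> ?T"
    then obtain xs ys where "s = square_sum X xs" "t = square_sum X ys"
      and *: "set xs \<subseteq> X" "set ys \<subseteq> X" by blast
    then have "s + t = square_sum X (xs @ ys)"
      by (simp only: square_sum_append)
    with * show "s + t \<in> ?T"
      by (intro image_eqI[of _ _ "xs @ ys"]) auto
  next
    fix s and c :: real assume "s \<in> ?T" "0 \<le> c"
    then obtain xs where s: "s = square_sum X xs" and xs: "set xs \<subseteq> X" by blast
    have "c *\<^sub>R s = square_sum X (map (\<lambda>x. sqrt c *\<^sub>R x) xs)"
      unfolding s by (rule square_sum_scaleR[OF xs X \<open>0 \<le> c\<close>])
    moreover have "set (map (\<lambda>x. sqrt c *\<^sub>R x) xs) \<subseteq> X"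
      using xs subspace_scale[OF X] by auto
    ultimately show "c *\<^sub>R s \<in> ?T" by blast
  qed
  moreover have "?S \<subseteq> ?T"
  proof
    fix t assume "t \<in> ?S"
    then obtain x where "x \<in> X" "t = square_sum X [x]" by (auto simp: square_sum_def)
    then show "t \<in> ?T" by (intro image_eqI[of _ _ "[x]"]) auto
  qed
  ultimately show "nonneg_tensors X \<subseteq> ?T"
    using hull_minimal[of ?S ?T convex] by (auto simp: nonneg_tensors_def)
  have "cone ?S"
    unfolding cone_def
  proof (intro ballI allI impI)
    fix s and c :: real assume "s \<in> ?S" "0 \<le> c"
    then obtain x where x: "x \<in> X" "s = elem_tensor X X x x" by blast
    then have "c *\<^sub>R s = elem_tensor X X (sqrt c *\<^sub>R x) (sqrt c *\<^sub>R x)"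
      using elem_tensor_scaleR[OF x(1) X, of "sqrt c"] \<open>0 \<le> c\<close> by simp
    then show "c *\<^sub>R s \<in> ?S"
      using subspace_scale[OF X x(1)] by blast
  qed
  then have "convex (convex hull ?S) \<and> cone (convex hull ?S)"
    using cone_convex_hull convex_convex_hull by blast
  then have add: "s + t \<in> convex hull ?S" if "s \<in> convex hull ?S" "t \<in> convex hull ?S" for s t
    using that unfolding convex_cone by blast
  have "square_sum X xs \<in> convex hull ?S" if "set xs \<subseteq> X" for xs
    using that
  proof (induction xs)
    case Nil
    \<comment> \<open>the zero tensor is the square of the zero vector, which covers the empty sum\<close>
    have "elem_tensor X X 0 0 = (0::('a, 'a) tensor)"
      using elem_tensor_scaleR[OF subspace_0[OF X] X, of 0] by simp
    then have "0 \<in> ?S"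
      using subspace_0[OF X] by (metis (mono_tags, lifting) mem_Collect_eq)
    then show ?case
      by (simp only: square_sum_Nil hull_inc)
  next
    case (Cons x xs)
    have "elem_tensor X X x x \<in> convex hull ?S"
      using Cons.prems by (intro hull_inc) auto
    with Cons show ?case
      unfolding square_sum_Cons by (intro add) auto
  qed
  moreover have "convex hull ?S \<subseteq> tensor_product X X"
    unfolding tensor_product_def
    by (rule order_trans[OF convex_hull_subset_span span_mono]) blast
  ultimately show "?T \<subseteq> nonneg_tensors X"
    by (auto simp: nonneg_tensors_def)
qed

section \<open>The dual of a normed space\<close>

lemma normed_space_onD:
  assumes "normed_space_on X N"
  shows "subspace X" "x \<in> X \<Longrightarrow> 0 \<le> N x" "x \<in> X \<Longrightarrow> N x = 0 \<longleftrightarrow> x = 0"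
    "x \<in> X \<Longrightarrow> N (c *\<^sub>R x) = \<bar>c\<bar> * N x"
  using assms by (auto simp: normed_space_on_def)

lemma dual_linear:
  assumes "f \<in> dual X N" "x \<in> X"
  shows "f (c *\<^sub>R x) = c * f x" "y \<in> X \<Longrightarrow> f (x + y) = f x + f y"
  using assms by (auto simp: dual_def linear_on_def)

lemma subspace_dual: "subspace (dual X N)"
  unfolding subspace_def
proof (intro conjI ballI allI)
  show "0 \<in> dual X N"
    by (auto simp: dual_def linear_on_def intro!: exI[of _ 0])
  fix f assume f: "f \<in> dual X N"
  then obtain C where C: "\<forall>x\<in>X. \<bar>f x\<bar> \<le> C * N x"
    by (auto simp: dual_def)
  show "c *\<^sub>R f \<in> dual X N" for c
  proof -
    from C have "\<forall>x\<in>X. \<bar>(c *\<^sub>R f) x\<bar> \<le> (\<bar>c\<bar> * C) * N x"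
      by (auto simp: scaleR_fun_def abs_mult mult.assoc intro: mult_left_mono)
    then have "\<exists>C. \<forall>x\<in>X. \<bar>(c *\<^sub>R f) x\<bar> \<le> C * N x" ..
    with f show ?thesis
      by (simp add: dual_def linear_on_def scaleR_fun_def distrib_left)
  qed
  fix g assume g: "g \<in> dual X N"
  then obtain D where "\<forall>x\<in>X. \<bar>g x\<bar> \<le> D * N x"
    by (auto simp: dual_def)
  with C have "\<forall>x\<in>X. \<bar>(f + g) x\<bar> \<le> (C + D) * N x"
    by (auto simp: distrib_right intro!: order_trans[OF abs_triangle_ineq] add_mono)
  then have "\<exists>C. \<forall>x\<in>X. \<bar>(f + g) x\<bar> \<le> C * N x" ..
  with f g show "f + g \<in> dual X N"
    by (simp add: dual_def linear_on_def distrib_left)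
qed

lemma bdd_above_dual:
  assumes "normed_space_on X N" "f \<in> dual X N"
  shows "bdd_above ((\<lambda>x. \<bar>f x\<bar>) ` {x\<in>X. N x \<le> 1})"
proof -
  obtain C where C: "\<forall>x\<in>X. \<bar>f x\<bar> \<le> C * N x"
    using assms(2) by (auto simp: dual_def)
  show ?thesis
  proof (rule bdd_aboveI2)
    fix x assume x: "x \<in> {x\<in>X. N x \<le> 1}"
    then have "\<bar>f x\<bar> \<le> C * N x" using C by auto
    also have "\<dots> \<le> \<bar>C\<bar> * 1"
      using x normed_space_onD(2)[OF assms(1)] by (intro mult_mono) auto
    finally show "\<bar>f x\<bar> \<le> \<bar>C\<bar>" by simp
  qed
qed

lemma dual_norm_le:
  assumes "normed_space_on X N" "\<And>x. x \<in> X \<Longrightarrow> N x \<le> 1 \<Longrightarrow> \<bar>f x\<bar> \<le> b"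
  shows "dual_norm X N f \<le> b"
  unfolding dual_norm_def
proof (rule cSUP_least)
  have "0 \<in> {x\<in>X. N x \<le> 1}"
    using normed_space_onD[OF assms(1)] subspace_0 by fastforce
  then show "{x\<in>X. N x \<le> 1} \<noteq> {}" by blast
qed (use assms(2) in auto)

lemma abs_le_dual_norm:
  assumes X: "normed_space_on X N" and f: "f \<in> dual X N" and x: "x \<in> X"
  shows "\<bar>f x\<bar> \<le> dual_norm X N f * N x"
proof (cases "x = 0")
  case True
  then show ?thesis
    using dual_linear(1)[OF f x, of 0] normed_space_onD(3)[OF X x] by simp
next
  case False
  then have pos: "N x > 0"
    using normed_space_onD(2,3)[OF X x] by linarith
  let ?y = "inverse (N x) *\<^sub>R x"
  have "N ?y = 1"
    using pos normed_space_onD(4)[OF X x] by simp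
  then have "?y \<in> {x\<in>X. N x \<le> 1}"
    using x normed_space_onD(1)[OF X] by (simp add: subspace_scale)
  then have "\<bar>f ?y\<bar> \<le> dual_norm X N f"
    unfolding dual_norm_def by (rule cSUP_upper[OF _ bdd_above_dual[OF X f]])
  then show ?thesis
    using pos dual_linear(1)[OF f x] by (simp add: abs_mult field_simps)
qed

lemma abs_le_norm_of_dual_ball:
  assumes "normed_space_on X N" "f \<in> dual_ball X N" "x \<in> X"
  shows "\<bar>f x\<bar> \<le> N x"
proof -
  have "\<bar>f x\<bar> \<le> dual_norm X N f * N x"
    using assms abs_le_dual_norm[of X N f x] by (simp add: dual_ball_def)
  also have "\<dots> \<le> 1 * N x"
    using assms normed_space_onD(2)[OF assms(1,3)]
    by (intro mult_right_mono) (auto simp: dual_ball_def)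
  finally show ?thesis by simp
qed

lemma dual_ballI:
  assumes X: "normed_space_on X N" and "linear_on X f" "\<And>x. x \<in> X \<Longrightarrow> \<bar>f x\<bar> \<le> N x"
    "\<And>x. x \<notin> X \<Longrightarrow> f x = 0"
  shows "f \<in> dual_ball X N"
proof -
  have "\<forall>x\<in>X. \<bar>f x\<bar> \<le> 1 * N x" using assms(3) by simp
  then have "f \<in> dual X N"
    using assms unfolding dual_def by blast
  moreover have "dual_norm X N f \<le> 1"
    using assms(3) by (intro dual_norm_le[OF X]) (meson order_trans)
  ultimately show ?thesis by (simp add: dual_ball_def)
qed

lemma normed_space_on_dual:
  assumes X: "normed_space_on X N"
  shows "normed_space_on (dual X N) (dual_norm X N)"
  unfolding normed_space_on_def
proof (intro conjI ballI allI)
  show "subspace (dual X N)" by (rule subspace_dual)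
  fix f assume f: "f \<in> dual X N"
  have "0 \<in> {x\<in>X. N x \<le> 1}"
    using normed_space_onD[OF X] subspace_0 by fastforce
  then have "\<bar>f 0\<bar> \<le> dual_norm X N f"
    unfolding dual_norm_def by (rule cSUP_upper[OF _ bdd_above_dual[OF X f]])
  then show nonneg: "0 \<le> dual_norm X N f" by simp
  show "dual_norm X N f = 0 \<longleftrightarrow> f = 0"
  proof
    assume "dual_norm X N f = 0"
    then have "f x = 0" for x
      using abs_le_dual_norm[OF X f, of x] f by (cases "x \<in> X") (auto simp: dual_def)
    then show "f = 0" by auto
  next
    assume "f = 0"
    then have "dual_norm X N f \<le> 0"
      by (intro dual_norm_le[OF X]) simp
    with nonneg show "dual_norm X N f = 0" by simp
  qed
  have scale_le: "dual_norm X N (c *\<^sub>R g) \<le> \<bar>c\<bar> * dual_norm X N g" if g: "g \<in> dual X N" for c g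
  proof (rule dual_norm_le[OF X])
    fix x assume "x \<in> X" "N x \<le> 1"
    then have "\<bar>g x\<bar> \<le> dual_norm X N g"
      unfolding dual_norm_def by (intro cSUP_upper[OF _ bdd_above_dual[OF X g]]) simp
    then show "\<bar>(c *\<^sub>R g) x\<bar> \<le> \<bar>c\<bar> * dual_norm X N g"
      by (simp add: scaleR_fun_def abs_mult mult_left_mono)
  qed
  show "dual_norm X N (c *\<^sub>R f) = \<bar>c\<bar> * dual_norm X N f" for c
  proof (rule antisym[OF scale_le[OF f]])
    show "\<bar>c\<bar> * dual_norm X N f \<le> dual_norm X N (c *\<^sub>R f)"
    proof (cases "c = 0")
      case True
      have "0 \<le> dual_norm X N 0"
      proof -
        have "0 \<in> {x\<in>X. N x \<le> 1}" by fact
        then have "\<bar>(0::'a \<Rightarrow> real) 0\<bar> \<le> dual_norm X N 0"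
          unfolding dual_norm_def
          by (rule cSUP_upper[OF _ bdd_above_dual[OF X subspace_0[OF subspace_dual]]])
        then show ?thesis by simp
      qed
      with True show ?thesis by simp
    next
      case False
      have "dual_norm X N (inverse c *\<^sub>R c *\<^sub>R f) \<le> \<bar>inverse c\<bar> * dual_norm X N (c *\<^sub>R f)"
        by (rule scale_le[OF subspace_scale[OF subspace_dual f]])
      with False show ?thesis by (simp add: field_simps)
    qed
  qed
  fix g assume g: "g \<in> dual X N"
  show "dual_norm X N (f + g) \<le> dual_norm X N f + dual_norm X N g"
  proof (rule dual_norm_le[OF X])
    fix x assume "x \<in> X" "N x \<le> 1"
    then have "\<bar>f x\<bar> \<le> dual_norm X N f" "\<bar>g x\<bar> \<le> dual_norm X N g"
      unfolding dual_norm_def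
      by (auto intro!: cSUP_upper bdd_above_dual[OF X] f g)
    then show "\<bar>(f + g) x\<bar> \<le> dual_norm X N f + dual_norm X N g"
      by simp
  qed
qed

section \<open>Injective norms of nonnegative tensors\<close>

lemma bilinear_on_dual_product:
  assumes "f \<in> dual X N" "g \<in> dual X N"
  shows "bilinear_on X X (\<lambda>x y. f x * g y)"
  using assms by (auto simp: bilinear_on_def linear_on_def dual_def algebra_simps)

lemma square_sum_dual_product:
  assumes "f \<in> dual X N" "g \<in> dual X N"
  shows "square_sum X xs (\<lambda>x y. f x * g y) = (\<Sum>x\<leftarrow>xs. f x * g x)"
  by (rule square_sum_apply[OF bilinear_on_dual_product[OF assms]])

text \<open>
  The supremum over pairs \<open>(f, g)\<close> equals the one over the diagonal, because
  \<open>2 \<bar>f(x) g(x)\<bar> \<le> f(x)\<^sup>2 + g(x)\<^sup>2\<close>.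
\<close>

lemma injective_norm_square_sum_le_iff:
  assumes X: "normed_space_on X N" and xs: "set xs \<subseteq> X"
  shows "injective_norm X N X N (square_sum X xs) \<le> a
    \<longleftrightarrow> (\<forall>f\<in>dual_ball X N. (\<Sum>x\<leftarrow>xs. (f x)\<^sup>2) \<le> a)"
proof -
  let ?B = "dual_ball X N"
  let ?F = "\<lambda>(f, g). \<bar>square_sum X xs (\<lambda>x y. f x * g y)\<bar>"
  have F: "?F (f, g) = \<bar>\<Sum>x\<leftarrow>xs. f x * g x\<bar>" if "f \<in> ?B" "g \<in> ?B" for f g
    using that square_sum_dual_product[of f X N g] by (simp add: dual_ball_def)
  have amgm: "\<bar>\<Sum>x\<leftarrow>ys. f x * g x\<bar> \<le> ((\<Sum>x\<leftarrow>ys. (f x)\<^sup>2) + (\<Sum>x\<leftarrow>ys. (g x)\<^sup>2)) / 2"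
    for f g :: "'a \<Rightarrow> real" and ys
  proof (induction ys)
    case (Cons y ys)
    have "\<bar>f y * g y\<bar> \<le> ((f y)\<^sup>2 + (g y)\<^sup>2) / 2"
      using sum_squares_bound[of "\<bar>f y\<bar>" "\<bar>g y\<bar>"] by (simp add: abs_mult)
    with Cons abs_triangle_ineq[of "f y * g y" "\<Sum>x\<leftarrow>ys. f x * g x"] show ?case by simp
  qed simp
  have bound: "(\<Sum>x\<leftarrow>xs. (f x)\<^sup>2) \<le> (\<Sum>x\<leftarrow>xs. (N x)\<^sup>2)" if "f \<in> ?B" for f
  proof (rule sum_list_mono)
    fix x assume "x \<in> set xs"
    then show "(f x)\<^sup>2 \<le> (N x)\<^sup>2"
      using abs_le_norm_of_dual_ball[OF X that] xs by (metis abs_le_square_iff abs_of_nonneg abs_ge_zero order_trans subsetD)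
  qed
  have bdd: "bdd_above (?F ` (?B \<times> ?B))"
  proof (rule bdd_aboveI2)
    fix p assume "p \<in> ?B \<times> ?B"
    then obtain f g where p: "p = (f, g)" "f \<in> ?B" "g \<in> ?B" by auto
    then show "?F p \<le> (\<Sum>x\<leftarrow>xs. (N x)\<^sup>2)"
      using F[OF p(2,3)] amgm[of f g xs] bound[OF p(2)] bound[OF p(3)] by simp
  qed
  have "0 \<in> ?B"
    by (rule dual_ballI[OF X]) (auto simp: linear_on_def normed_space_onD[OF X])
  then have ne: "?B \<times> ?B \<noteq> {}" by blast
  have eq: "injective_norm X N X N (square_sum X xs) = (SUP p\<in>?B \<times> ?B. ?F p)"
    by (simp add: injective_norm_def)
  show ?thesis
  proof
    assume le: "injective_norm X N X N (square_sum X xs) \<le> a"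
    show "\<forall>f\<in>?B. (\<Sum>x\<leftarrow>xs. (f x)\<^sup>2) \<le> a"
    proof
      fix f assume f: "f \<in> ?B"
      then have "?F (f, f) \<le> (SUP p\<in>?B \<times> ?B. ?F p)"
        by (intro cSUP_upper bdd) simp
      with F[OF f f] le eq show "(\<Sum>x\<leftarrow>xs. (f x)\<^sup>2) \<le> a"
        by (simp add: power2_eq_square)
    qed
  next
    assume a: "\<forall>f\<in>?B. (\<Sum>x\<leftarrow>xs. (f x)\<^sup>2) \<le> a"
    show "injective_norm X N X N (square_sum X xs) \<le> a"
      unfolding eq
    proof (rule cSUP_least[OF ne])
      fix p assume "p \<in> ?B \<times> ?B"
      then obtain f g where p: "p = (f, g)" "f \<in> ?B" "g \<in> ?B" by auto
      with a have "(\<Sum>x\<leftarrow>xs. (f x)\<^sup>2) \<le> a" "(\<Sum>x\<leftarrow>xs. (g x)\<^sup>2) \<le> a" by auto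
      then show "?F p \<le> a"
        using F[OF p(2,3)] amgm[of f g xs] p(1) by simp
    qed
  qed
qed

text \<open>
  The points of the unit ball of \<open>X\<close> norm the tensors \<open>\<Sum>f \<otimes> f\<close>, although \<open>X\<close> may fail to be
  reflexive.  For \<open>\<phi>\<close> in the bidual ball, the value \<open>s = \<Sum>\<phi>(f)\<^sup>2\<close> is itself \<open>\<phi>(g)\<close> for the
  functional \<open>g = \<Sum>\<phi>(f) f\<close>, and hence at most \<open>\<parallel>g\<parallel>\<close>; on the unit ball of \<open>X\<close>, the inequality of
  the arithmetic and geometric means gives \<open>\<bar>g(x)\<bar> \<le> (s + \<Sum>f(x)\<^sup>2) / 2 \<le> (s + b) / 2\<close>.  So
  \<open>s \<le> (s + b) / 2\<close>, that is, \<open>s \<le> b\<close>.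
\<close>

lemma bidual_ball_square_sum_le_iff:
  assumes X: "normed_space_on X N" and fs: "set fs \<subseteq> dual X N"
  shows "(\<forall>\<phi>\<in>dual_ball (dual X N) (dual_norm X N). (\<Sum>f\<leftarrow>fs. (\<phi> f)\<^sup>2) \<le> b)
    \<longleftrightarrow> (\<forall>x\<in>X. N x \<le> 1 \<longrightarrow> (\<Sum>f\<leftarrow>fs. (f x)\<^sup>2) \<le> b)"
proof (intro iffI ballI impI)
  let ?D = "dual X N" and ?M = "dual_norm X N"
  note D = normed_space_on_dual[OF X]
  {
    assume b: "\<forall>\<phi>\<in>dual_ball ?D ?M. (\<Sum>f\<leftarrow>fs. (\<phi> f)\<^sup>2) \<le> b"
    fix x assume x: "x \<in> X" "N x \<le> 1"
    define \<phi> where "\<phi> f = (if f \<in> ?D then f x else 0)" for f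
    have "\<phi> \<in> dual_ball ?D ?M"
    proof (rule dual_ballI[OF D])
      show "linear_on ?D \<phi>"
        unfolding linear_on_def
      proof (intro conjI ballI allI)
        fix f g and c :: real assume "f \<in> ?D" "g \<in> ?D"
        moreover from this have "f + g \<in> ?D" "c *\<^sub>R f \<in> ?D"
          using subspace_add[OF subspace_dual] subspace_scale[OF subspace_dual] by auto
        ultimately show "\<phi> (f + g) = \<phi> f + \<phi> g" "\<phi> (c *\<^sub>R f) = c *\<^sub>R \<phi> f"
          unfolding \<phi>_def by (simp_all only: if_True) (simp_all add: scaleR_fun_def)
      qed
      show "\<bar>\<phi> f\<bar> \<le> ?M f" if "f \<in> ?D" for f
        unfolding \<phi>_def dual_norm_def using that x
        by (auto intro!: cSUP_upper2[OF bdd_above_dual[OF X that]])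
    qed (simp add: \<phi>_def)
    with b have "(\<Sum>f\<leftarrow>fs. (\<phi> f)\<^sup>2) \<le> b" by blast
    moreover have "map (\<lambda>f. (\<phi> f)\<^sup>2) fs = map (\<lambda>f. (f x)\<^sup>2) fs"
      using fs by (auto simp: \<phi>_def)
    ultimately show "(\<Sum>f\<leftarrow>fs. (f x)\<^sup>2) \<le> b" by simp
  }
  {
    assume b: "\<forall>x\<in>X. N x \<le> 1 \<longrightarrow> (\<Sum>f\<leftarrow>fs. (f x)\<^sup>2) \<le> b"
    fix \<phi> assume \<phi>: "\<phi> \<in> dual_ball ?D ?M"
    define g where "g = (\<Sum>f\<leftarrow>fs. \<phi> f *\<^sub>R f)"
    define s where "s = (\<Sum>f\<leftarrow>fs. (\<phi> f)\<^sup>2)"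
    have \<phi>D: "\<phi> \<in> dual ?D ?M" using \<phi> by (simp add: dual_ball_def)
    have "set hs \<subseteq> ?D \<Longrightarrow> (\<Sum>f\<leftarrow>hs. \<phi> f *\<^sub>R f) \<in> ?D \<and>
        \<phi> (\<Sum>f\<leftarrow>hs. \<phi> f *\<^sub>R f) = (\<Sum>f\<leftarrow>hs. (\<phi> f)\<^sup>2)" for hs
    proof (induction hs)
      case Nil
      have "\<phi> 0 = 0"
        using dual_linear(1)[OF \<phi>D subspace_0[OF subspace_dual], of 0] by simp
      then show ?case
        by (simp only: list.map sum_list.Nil subspace_0[OF subspace_dual] simp_thms)
    next
      case (Cons h hs)
      then have h: "\<phi> h *\<^sub>R h \<in> ?D" "h \<in> ?D" "(\<Sum>f\<leftarrow>hs. \<phi> f *\<^sub>R f) \<in> ?D"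
        using subspace_scale[OF subspace_dual] by auto
      have "\<phi> (\<phi> h *\<^sub>R h + (\<Sum>f\<leftarrow>hs. \<phi> f *\<^sub>R f)) = (\<phi> h)\<^sup>2 + (\<Sum>f\<leftarrow>hs. (\<phi> f)\<^sup>2)"
        using Cons dual_linear(1)[OF \<phi>D h(2)] dual_linear(2)[OF \<phi>D h(1,3)]
        by (simp add: power2_eq_square)
      with subspace_add[OF subspace_dual h(1,3)] show ?case
        by (simp only: list.map sum_list.Cons simp_thms)
    qed
    with fs have g: "g \<in> ?D" "\<phi> g = s"
      by (auto simp: g_def s_def)
    have "?M g \<le> (s + b) / 2"
    proof (rule dual_norm_le[OF X])
      fix x assume x: "x \<in> X" "N x \<le> 1"
      have "\<bar>(\<Sum>f\<leftarrow>hs. \<phi> f *\<^sub>R f) x\<bar> \<le> ((\<Sum>f\<leftarrow>hs. (\<phi> f)\<^sup>2) + (\<Sum>f\<leftarrow>hs. (f x)\<^sup>2)) / 2" for hs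
      proof (induction hs)
        case (Cons h hs)
        have "\<bar>\<phi> h * h x\<bar> \<le> ((\<phi> h)\<^sup>2 + (h x)\<^sup>2) / 2"
          using sum_squares_bound[of "\<bar>\<phi> h\<bar>" "\<bar>h x\<bar>"] by (simp add: abs_mult)
        with Cons abs_triangle_ineq[of "\<phi> h * h x" "(\<Sum>f\<leftarrow>hs. \<phi> f *\<^sub>R f) x"] show ?case
          by (simp add: scaleR_fun_def[of _ "_::'a\<Rightarrow>real"])
      qed simp
      from this[of fs] show "\<bar>g x\<bar> \<le> (s + b) / 2"
        using b x by (force simp: g_def s_def)
    qed
    moreover have "\<bar>s\<bar> \<le> ?M g"
      using abs_le_norm_of_dual_ball[OF D \<phi> g(1)] g(2) by simp
    ultimately show "(\<Sum>f\<leftarrow>fs. (\<phi> f)\<^sup>2) \<le> b"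
      unfolding s_def[symmetric] by (simp add: field_simps)
  }
qed

lemma tensor_pairing_square_sums:
  assumes fs: "set fs \<subseteq> dual X N"
  shows "tensor_pairing (square_sum X xs) (square_sum (dual X N) fs)
    = (\<Sum>f\<leftarrow>fs. \<Sum>x\<leftarrow>xs. (f x)\<^sup>2)"
proof -
  let ?D = "dual X N"
  let ?\<Phi> = "\<lambda>f g. square_sum X xs (\<lambda>x y. f x * g y)"
  have \<Phi>: "?\<Phi> f g = (\<Sum>x\<leftarrow>xs. f x * g x)" if "f \<in> ?D" "g \<in> ?D" for f g
    by (rule square_sum_dual_product[OF that])
  have *: "f + g \<in> ?D" "c *\<^sub>R f \<in> ?D" if "f \<in> ?D" "g \<in> ?D" for f g c
    using that subspace_add[OF subspace_dual] subspace_scale[OF subspace_dual] by auto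
  have "bilinear_on ?D ?D ?\<Phi>"
    unfolding bilinear_on_def linear_on_def
    by (simp only: \<Phi> * simp_thms ball_simps cong: ball_cong)
      (simp add: scaleR_fun_def[of _ "_::'a\<Rightarrow>real"] distrib_left distrib_right mult.assoc
        mult.left_commute sum_list_addf sum_list_const_mult)
  then have "tensor_pairing (square_sum X xs) (square_sum ?D fs) = (\<Sum>f\<leftarrow>fs. ?\<Phi> f f)"
    unfolding tensor_pairing_def by (rule square_sum_apply)
  also have "map (\<lambda>f. ?\<Phi> f f) fs = map (\<lambda>f. \<Sum>x\<leftarrow>xs. (f x)\<^sup>2) fs"
    using fs \<Phi> by (auto simp: power2_eq_square)
  finally show ?thesis .
qed

section \<open>The constant \<open>\<gamma>\<close> as a bound for systems of vectors and functionals\<close>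

lemma injective_norm_nonneg:
  assumes X: "normed_space_on X N" and xs: "set xs \<subseteq> X"
  shows "0 \<le> injective_norm X N X N (square_sum X xs)"
proof -
  have "0 \<in> dual_ball X N"
    by (rule dual_ballI[OF X]) (auto simp: linear_on_def normed_space_onD[OF X])
  then show ?thesis
    using injective_norm_square_sum_le_iff[OF X xs, of "injective_norm X N X N (square_sum X xs)"]
    by fastforce
qed

lemma injective_norm_dual_square_sum_le_iff:
  assumes X: "normed_space_on X N" and fs: "set fs \<subseteq> dual X N"
  shows "injective_norm (dual X N) (dual_norm X N) (dual X N) (dual_norm X N)
      (square_sum (dual X N) fs) \<le> b
    \<longleftrightarrow> (\<forall>x\<in>X. N x \<le> 1 \<longrightarrow> (\<Sum>f\<leftarrow>fs. (f x)\<^sup>2) \<le> b)"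
  using injective_norm_square_sum_le_iff[OF normed_space_on_dual[OF X] fs]
    bidual_ball_square_sum_le_iff[OF X fs] by simp

text \<open>
  The inequality between \<open>\<gamma>\<close> and the two weak 2-norms, in the form in which it is applied to
  concrete vectors and functionals.
\<close>

lemma sum_squares_le_of_gamma_const_less:
  assumes X: "normed_space_on X N" and c: "0 \<le> c" "gamma_const X N < ereal c"
    and xs: "set xs \<subseteq> X" and a: "\<And>f. f \<in> dual_ball X N \<Longrightarrow> (\<Sum>x\<leftarrow>xs. (f x)\<^sup>2) \<le> a"
    and fs: "set fs \<subseteq> dual X N" and b: "\<And>x. x \<in> X \<Longrightarrow> N x \<le> 1 \<Longrightarrow> (\<Sum>f\<leftarrow>fs. (f x)\<^sup>2) \<le> b"
  shows "(\<Sum>f\<leftarrow>fs. \<Sum>x\<leftarrow>xs. (f x)\<^sup>2) \<le> c * a * b"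
proof -
  let ?A = "square_sum X xs" and ?B = "square_sum (dual X N) fs"
  let ?nA = "injective_norm X N X N ?A"
  let ?nB = "injective_norm (dual X N) (dual_norm X N) (dual X N) (dual_norm X N) ?B"
  obtain d where "d < c" and d: "\<forall>A \<in> nonneg_tensors X. \<forall>B \<in> nonneg_tensors (dual X N).
         tensor_pairing A B
           \<le> d * injective_norm X N X N A
               * injective_norm (dual X N) (dual_norm X N) (dual X N) (dual_norm X N) B"
    using c(2) unfolding gamma_const_def Inf_less_iff by auto
  have "?A \<in> nonneg_tensors X" "?B \<in> nonneg_tensors (dual X N)"
    using xs fs nonneg_tensors_eq_square_sums normed_space_onD(1)[OF X] subspace_dual by blast+
  with d have "(\<Sum>f\<leftarrow>fs. \<Sum>x\<leftarrow>xs. (f x)\<^sup>2) \<le> d * ?nA * ?nB"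
    unfolding tensor_pairing_square_sums[OF fs, symmetric] by blast
  also have "\<dots> \<le> c * ?nA * ?nB"
    using \<open>d < c\<close> injective_norm_nonneg[OF X xs] injective_norm_nonneg[OF normed_space_on_dual[OF X] fs]
    by (intro mult_right_mono) auto
  also have "\<dots> \<le> c * a * b"
  proof -
    have "?nA \<le> a" "?nB \<le> b"
      using injective_norm_square_sum_le_iff[OF X xs] a
        injective_norm_dual_square_sum_le_iff[OF X fs] b by auto
    then show ?thesis
      using c(1) injective_norm_nonneg[OF X xs] injective_norm_nonneg[OF normed_space_on_dual[OF X] fs]
      by (intro mult_mono mult_nonneg_nonneg) auto
  qed
  finally show ?thesis .
qed

lemma sum_list_scaled_squares:
  fixes f :: "'a::real_vector \<Rightarrow> real"
  assumes "\<And>x. x \<in> set xs \<Longrightarrow> f (t *\<^sub>R x) = t * f x"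
  shows "(\<Sum>x\<leftarrow>map ((*\<^sub>R) t) xs. (f x)\<^sup>2) = t\<^sup>2 * (\<Sum>x\<leftarrow>xs. (f x)\<^sup>2)"
  using assms by (induction xs) (auto simp: power_mult_distrib distrib_left)

text \<open>
  A violation of the bound by some pair of tensors can be normalised so that both weak 2-norms are
  at most 1.
\<close>

lemma large_sum_squares_of_gamma_const_greater:
  assumes X: "normed_space_on X N" and c: "ereal c < gamma_const X N"
  obtains xs fs where "set xs \<subseteq> X" "set fs \<subseteq> dual X N"
    "\<And>f. f \<in> dual_ball X N \<Longrightarrow> (\<Sum>x\<leftarrow>xs. (f x)\<^sup>2) \<le> 1"
    "\<And>x. x \<in> X \<Longrightarrow> N x \<le> 1 \<Longrightarrow> (\<Sum>f\<leftarrow>fs. (f x)\<^sup>2) \<le> 1"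
    "c < (\<Sum>f\<leftarrow>fs. \<Sum>x\<leftarrow>xs. (f x)\<^sup>2)"
proof -
  let ?D = "dual X N" and ?M = "dual_norm X N"
  note D = normed_space_on_dual[OF X] and subX = normed_space_onD(1)[OF X]
  have "\<not> (\<forall>A \<in> nonneg_tensors X. \<forall>B \<in> nonneg_tensors ?D. tensor_pairing A B
           \<le> c * injective_norm X N X N A * injective_norm ?D ?M ?D ?M B)"
  proof
    assume "\<forall>A \<in> nonneg_tensors X. \<forall>B \<in> nonneg_tensors ?D. tensor_pairing A B
           \<le> c * injective_norm X N X N A * injective_norm ?D ?M ?D ?M B"
    then have "gamma_const X N \<le> ereal c"
      unfolding gamma_const_def by (intro Inf_lower) blast
    with c show False by simp
  qed
  then obtain xs fs where xs: "set xs \<subseteq> X" and fs: "set fs \<subseteq> ?D"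
    and "c * injective_norm X N X N (square_sum X xs) * injective_norm ?D ?M ?D ?M (square_sum ?D fs)
      < tensor_pairing (square_sum X xs) (square_sum ?D fs)"
    unfolding nonneg_tensors_eq_square_sums[OF subX] nonneg_tensors_eq_square_sums[OF subspace_dual]
    by (auto simp: not_le)
  moreover define a where "a = injective_norm X N X N (square_sum X xs)"
  moreover define b where "b = injective_norm ?D ?M ?D ?M (square_sum ?D fs)"
  moreover define S where "S = (\<Sum>f\<leftarrow>fs. \<Sum>x\<leftarrow>xs. (f x)\<^sup>2)"
  ultimately have S: "c * a * b < S"
    by (simp add: tensor_pairing_square_sums[OF fs])
  \<comment> \<open>\<open>a\<close> or \<open>b\<close> may vanish, so the normalisation divides by slightly larger numbers\<close>
  have "((\<lambda>e. c * (a + e) * (b + e)) \<longlongrightarrow> c * (a + 0) * (b + 0)) (at_right 0)"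
    by (intro tendsto_intros)
  then have "\<forall>\<^sub>F e in at_right 0. c * (a + e) * (b + e) < S"
    using S by (intro order_tendstoD(2)) auto
  then have "\<forall>\<^sub>F e in at_right 0. c * (a + e) * (b + e) < S \<and> 0 < e"
    using eventually_at_right_less[of 0] by (rule eventually_conj)
  then obtain e where e: "0 < e" "c * (a + e) * (b + e) < S"
    using eventually_happens'[OF trivial_limit_at_right_real] by blast
  have ab: "0 < a + e" "0 < b + e"
    using e(1) injective_norm_nonneg[OF X xs] injective_norm_nonneg[OF D fs]
    by (simp_all add: a_def b_def)
  define s where "s = inverse (sqrt (a + e))"
  define t where "t = inverse (sqrt (b + e))"
  have st: "s\<^sup>2 = inverse (a + e)" "t\<^sup>2 = inverse (b + e)"
    using ab by (simp_all add: s_def t_def power_inverse)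
  let ?xs = "map ((*\<^sub>R) s) xs" and ?fs = "map ((*\<^sub>R) t) fs"
  have scaled: "(\<Sum>x\<leftarrow>?xs. (f x)\<^sup>2) = s\<^sup>2 * (\<Sum>x\<leftarrow>xs. (f x)\<^sup>2)" if "f \<in> ?D" for f
    using xs dual_linear(1)[OF that] by (intro sum_list_scaled_squares) auto
  have scaled': "(\<Sum>f\<leftarrow>?fs. (f x)\<^sup>2) = t\<^sup>2 * (\<Sum>f\<leftarrow>fs. (f x)\<^sup>2)" for x
    by (rule sum_list_scaled_squares[of fs "\<lambda>f. f x"]) (simp add: scaleR_fun_def)
  show thesis
  proof
    show "set ?xs \<subseteq> X" "set ?fs \<subseteq> ?D"
      using xs fs by (auto intro!: subspace_scale[OF subX] subspace_scale[OF subspace_dual])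
    show "(\<Sum>x\<leftarrow>?xs. (f x)\<^sup>2) \<le> 1" if "f \<in> dual_ball X N" for f
    proof -
      have "(\<Sum>x\<leftarrow>xs. (f x)\<^sup>2) \<le> a"
        using injective_norm_square_sum_le_iff[OF X xs, of a] that by (simp add: a_def)
      with that e(1) ab show ?thesis
        by (subst scaled) (auto simp: dual_ball_def st field_simps)
    qed
    show "(\<Sum>f\<leftarrow>?fs. (f x)\<^sup>2) \<le> 1" if "x \<in> X" "N x \<le> 1" for x
    proof -
      have "(\<Sum>f\<leftarrow>fs. (f x)\<^sup>2) \<le> b"
        using injective_norm_dual_square_sum_le_iff[OF X fs, of b] that by (simp add: b_def)
      with e(1) ab show ?thesis
        by (subst scaled') (auto simp: st field_simps)
    qed
    have "set ?fs \<subseteq> ?D" by fact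
    then have "map (\<lambda>f. \<Sum>x\<leftarrow>?xs. (f x)\<^sup>2) ?fs = map (\<lambda>f. s\<^sup>2 * (\<Sum>x\<leftarrow>xs. (f x)\<^sup>2)) ?fs"
      using scaled by (intro map_cong refl) blast
    then have "(\<Sum>f\<leftarrow>?fs. \<Sum>x\<leftarrow>?xs. (f x)\<^sup>2) = (\<Sum>f\<leftarrow>?fs. s\<^sup>2 * (\<Sum>x\<leftarrow>xs. (f x)\<^sup>2))"
      by (rule arg_cong)
    also have "\<dots> = s\<^sup>2 * (\<Sum>f\<leftarrow>?fs. \<Sum>x\<leftarrow>xs. (f x)\<^sup>2)"
      by (rule sum_list_const_mult)
    also have "(\<Sum>f\<leftarrow>?fs. \<Sum>x\<leftarrow>xs. (f x)\<^sup>2) = t\<^sup>2 * S"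
      unfolding S_def
      by (simp add: o_def scaleR_fun_def power_mult_distrib sum_list_const_mult)
    also have "s\<^sup>2 * (t\<^sup>2 * S) = S / ((a + e) * (b + e))"
      by (simp add: st field_simps)
    finally show "c < (\<Sum>f\<leftarrow>?fs. \<Sum>x\<leftarrow>?xs. (f x)\<^sup>2)"
      using e(2) ab by (simp add: pos_less_divide_eq mult.assoc)
  qed
qed


section \<open>Operators into the space of square-summable sequences\<close>

lemma summable_ell2: "summable (\<lambda>i. (ell2_nth y i)\<^sup>2)"
  using ell2_nth[of y] by simp

lemma norm_ell2_squared: "(norm y)\<^sup>2 = (\<Sum>i. (ell2_nth y i)\<^sup>2)"
  by (simp add: norm_ell2.rep_eq suminf_nonneg summable_ell2)

lemma sum_squares_le_norm_ell2:
  assumes "finite A"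
  shows "(\<Sum>i\<in>A. (ell2_nth y i)\<^sup>2) \<le> (norm y)\<^sup>2"
  unfolding norm_ell2_squared using assms by (intro sum_le_suminf summable_ell2) auto

lemma ell2_nth_add: "ell2_nth (x + y) i = ell2_nth x i + ell2_nth y i"
  and ell2_nth_scaleR: "ell2_nth (c *\<^sub>R x) i = c * ell2_nth x i"
  by (simp_all add: plus_ell2.rep_eq scaleR_ell2.rep_eq)

text \<open>
  A bound that is uniform over the finite sections makes the coordinates square-summable.
\<close>

lemma operator_into_ell2:
  fixes h :: "nat \<Rightarrow> 'a::real_normed_vector \<Rightarrow> real"
  assumes lin: "\<And>i. linear (h i)" and C: "0 \<le> C"
    and bound: "\<And>m x. (\<Sum>i<m. (h i x)\<^sup>2) \<le> (C * norm x)\<^sup>2"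
  obtains v where "bounded_linear v" "\<And>x i. ell2_nth (v x) i = h i x"
proof
  define v where "v x = Abs_ell2 (\<lambda>i. h i x)" for x
  have "summable (\<lambda>i. (h i x)\<^sup>2)" for x
    by (rule bounded_imp_summable[where B = "(C * norm x)\<^sup>2"])
      (simp_all only: bound lessThan_Suc_atMost[symmetric] zero_le_power2)
  then show nth: "ell2_nth (v x) i = h i x" for x i
    by (simp add: v_def Abs_ell2_inverse)
  have eqI: "y = z" if "\<And>i. ell2_nth y i = ell2_nth z i" for y z
    using that by (simp add: ell2_nth_inject[symmetric] fun_eq_iff)
  show "bounded_linear v"
  proof (rule bounded_linear_intro)
    show "v (x + y) = v x + v y" for x y
      by (rule eqI) (simp add: nth ell2_nth_add linear_add[OF lin])
    show "v (c *\<^sub>R x) = c *\<^sub>R v x" for c x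
      by (rule eqI) (simp add: nth ell2_nth_scaleR linear_scale[OF lin])
    show "norm (v x) \<le> norm x * C" for x
    proof (rule power2_le_imp_le)
      have "(\<Sum>i. (ell2_nth (v x) i)\<^sup>2) \<le> (C * norm x)\<^sup>2"
        by (rule suminf_le_const[OF summable_ell2]) (simp add: nth bound)
      then show "(norm (v x))\<^sup>2 \<le> (norm x * C)\<^sup>2"
        by (simp add: norm_ell2_squared mult.commute)
    qed (use C in simp)
  qed
qed

section \<open>Uniformly complemented subspaces of a Hilbert-Schmidt space\<close>

lemma normed_space_on_norm: "subspace X \<Longrightarrow> normed_space_on X norm"
  by (simp add: normed_space_on_def norm_triangle_ineq)

lemma restrict_blinfun_in_dual_ball:
  fixes \<phi> :: "'a::real_normed_vector \<Rightarrow>\<^sub>L real"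
  assumes X: "subspace X" and \<phi>: "norm \<phi> \<le> 1"
  shows "(\<lambda>x. if x \<in> X then \<phi> x else 0) \<in> dual_ball X norm"
proof (rule dual_ballI[OF normed_space_on_norm[OF X]])
  show "linear_on X (\<lambda>x. if x \<in> X then \<phi> x else 0)"
    using subspace_add[OF X] subspace_scale[OF X]
    by (simp add: linear_on_def blinfun.add_right blinfun.scaleR_right)
  show "\<bar>if x \<in> X then \<phi> x else 0\<bar> \<le> norm x" if "x \<in> X" for x
    using norm_blinfun[of \<phi> x] mult_right_mono[OF \<phi>, of "norm x"] that by simp
qed simp

text \<open>
  The supremum that defines the square of the weak 2-norm is over a bounded set, so it is an upper
  bound and not an arbitrary default value.
\<close>

lemma sum_squares_le_weak_norm:
  fixes x :: "'b \<Rightarrow> 'a::real_normed_vector" and \<phi> :: "'a \<Rightarrow>\<^sub>L real"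
  assumes "norm \<phi> \<le> 1"
  shows "(\<Sum>i\<in>A. (\<phi> (x i))\<^sup>2)
    \<le> (SUP f \<in> {f :: 'a \<Rightarrow>\<^sub>L real. norm f \<le> 1}. \<Sum>i\<in>A. (blinfun_apply f (x i))\<^sup>2)"
proof (rule cSUP_upper[where f = "\<lambda>f. \<Sum>i\<in>A. (blinfun_apply f (x i))\<^sup>2"])
  show "bdd_above ((\<lambda>f. \<Sum>i\<in>A. (blinfun_apply f (x i))\<^sup>2)
      ` {f :: 'a \<Rightarrow>\<^sub>L real. norm f \<le> 1})"
  proof (rule bdd_aboveI2)
    fix f :: "'a \<Rightarrow>\<^sub>L real" assume f: "f \<in> {f. norm f \<le> 1}"
    show "(\<Sum>i\<in>A. (f (x i))\<^sup>2) \<le> (\<Sum>i\<in>A. (norm (x i))\<^sup>2)"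
    proof (rule sum_mono)
      fix i
      have "\<bar>f (x i)\<bar> \<le> norm (x i)"
        using norm_blinfun[of f "x i"] mult_right_mono[of "norm f" 1 "norm (x i)"] f by simp
      then show "(f (x i))\<^sup>2 \<le> (norm (x i))\<^sup>2"
        by (simp add: abs_le_square_iff[symmetric])
    qed
  qed
qed (use assms in simp)

lemma sum_squares_le_norm_squared:
  assumes X: "normed_space_on X N" and fs: "set fs \<subseteq> dual X N"
    and b: "\<And>x. x \<in> X \<Longrightarrow> N x \<le> 1 \<Longrightarrow> (\<Sum>f\<leftarrow>fs. (f x)\<^sup>2) \<le> 1" and x: "x \<in> X"
  shows "(\<Sum>f\<leftarrow>fs. (f x)\<^sup>2) \<le> (N x)\<^sup>2"
proof (cases "x = 0")
  case True
  have "map (\<lambda>f. (f x)\<^sup>2) fs = map (\<lambda>f. 0) fs"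
    using fs dual_linear(1)[OF _ x, of _ N 0] True by (auto simp: subset_iff)
  then have "(\<Sum>f\<leftarrow>fs. (f x)\<^sup>2) = (\<Sum>f\<leftarrow>fs. 0)" by (rule arg_cong)
  then show ?thesis by simp
next
  case False
  then have pos: "N x > 0"
    using normed_space_onD(2,3)[OF X x] by linarith
  let ?y = "inverse (N x) *\<^sub>R x"
  have "N ?y = 1"
    using pos normed_space_onD(4)[OF X x] by simp
  then have "(\<Sum>f\<leftarrow>fs. (f ?y)\<^sup>2) \<le> 1"
    using subspace_scale[OF normed_space_onD(1)[OF X] x] by (intro b) auto
  also have "(\<Sum>f\<leftarrow>fs. (f ?y)\<^sup>2) = (\<Sum>f\<leftarrow>fs. (inverse (N x))\<^sup>2 * (f x)\<^sup>2)"
    by (intro arg_cong[where f = sum_list] map_cong refl)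
      (simp add: dual_linear(1)[OF subsetD[OF fs] x] power_mult_distrib)
  finally have "(inverse (N x))\<^sup>2 * (\<Sum>f\<leftarrow>fs. (f x)\<^sup>2) \<le> 1"
    by (simp only: sum_list_const_mult)
  then show ?thesis
    using pos by (simp add: field_simps)
qed

lemma sum_list_eq_sum_lessThan: "(\<Sum>x\<leftarrow>xs. F x) = (\<Sum>i<length xs. F (xs ! i))"
  by (simp add: sum_list_sum_nth atLeast0LessThan)

lemma sum_quarter_powers_le: "(\<Sum>k<m. (1/4)^k) \<le> (4::real)"
proof -
  have "(\<Sum>k<m. (1/4)^k) = (4/3) * (1 - (1/4::real)^m)"
    by (induction m) (simp_all add: algebra_simps)
  also have "\<dots> \<le> 4"
    by (simp add: field_simps)
  finally show ?thesis .
qed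

text \<open>
  The gliding hump.  The blocks \<open>2\<^bsup>-k\<^esup> u\<^sub>k P\<^bsub>i(k)\<^esub>\<close> act on disjoint sets of coordinates, indexed by pairs
  \<open>(k, j)\<close>.  Their squared norms are at most \<open>4\<^bsup>-k\<^esup> K\<^sup>2\<close>, which is summable, while on the
  \<open>k\<close>-th system of vectors the \<open>k\<close>-th block alone contributes more than \<open>4\<^bsup>-k\<^esup> 8\<^sup>k = 2\<^sup>k\<close>.
\<close>

lemma gamma_const_bounded_if_hilbert_schmidt_space:
  fixes E :: "'i \<Rightarrow> 'a::banach set" and P :: "'i \<Rightarrow> 'a \<Rightarrow>\<^sub>L 'a"
  assumes HS: "hilbert_schmidt_space TYPE('a)"
    and sub: "\<And>i. i \<in> I \<Longrightarrow> subspace (E i)"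
    and range: "\<And>i x. i \<in> I \<Longrightarrow> P i x \<in> E i"
    and proj: "\<And>i x. i \<in> I \<Longrightarrow> x \<in> E i \<Longrightarrow> P i x = x"
    and K: "\<And>i. i \<in> I \<Longrightarrow> norm (P i) \<le> K"
  shows "\<exists>c::real. \<forall>i\<in>I. gamma_const (E i) norm \<le> ereal c"
proof (rule ccontr)
  assume "\<not> ?thesis"
  then have unbounded: "\<exists>i\<in>I. ereal c < gamma_const (E i) norm" for c
    by (auto simp: not_le)
  have "\<exists>i xs fs. i \<in> I \<and> set xs \<subseteq> E i \<and> set fs \<subseteq> dual (E i) norm \<and>
    (\<forall>f\<in>dual_ball (E i) norm. (\<Sum>x\<leftarrow>xs. (f x)\<^sup>2) \<le> 1) \<and>
    (\<forall>x\<in>E i. norm x \<le> 1 \<longrightarrow> (\<Sum>f\<leftarrow>fs. (f x)\<^sup>2) \<le> 1) \<and>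
    8^k < (\<Sum>f\<leftarrow>fs. \<Sum>x\<leftarrow>xs. (f x)\<^sup>2)" for k :: nat
  proof -
    obtain i where i: "i \<in> I" and c: "ereal (8^k) < gamma_const (E i) norm"
      using unbounded by blast
    show ?thesis
      by (rule large_sum_squares_of_gamma_const_greater[OF normed_space_on_norm[OF sub[OF i]] c])
        (use i in blast)
  qed
  then obtain i xs fs where data: "\<And>k. i k \<in> I \<and> set (xs k) \<subseteq> E (i k) \<and>
    set (fs k) \<subseteq> dual (E (i k)) norm \<and>
    (\<forall>f\<in>dual_ball (E (i k)) norm. (\<Sum>x\<leftarrow>xs k. (f x)\<^sup>2) \<le> 1) \<and>
    (\<forall>x\<in>E (i k). norm x \<le> 1 \<longrightarrow> (\<Sum>f\<leftarrow>fs k. (f x)\<^sup>2) \<le> 1) \<and>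
    8^k < (\<Sum>f\<leftarrow>fs k. \<Sum>x\<leftarrow>xs k. (f x)\<^sup>2)"
    by metis
  have i: "i k \<in> I" and xs: "set (xs k) \<subseteq> E (i k)" and fs: "set (fs k) \<subseteq> dual (E (i k)) norm"
    and xs_le: "\<And>f. f \<in> dual_ball (E (i k)) norm \<Longrightarrow> (\<Sum>x\<leftarrow>xs k. (f x)\<^sup>2) \<le> 1"
    and fs_le: "\<And>x. x \<in> E (i k) \<Longrightarrow> norm x \<le> 1 \<Longrightarrow> (\<Sum>f\<leftarrow>fs k. (f x)\<^sup>2) \<le> 1"
    and large: "8^k < (\<Sum>f\<leftarrow>fs k. \<Sum>x\<leftarrow>xs k. (f x)\<^sup>2)" for k
    using data[of k] by auto
  have K0: "0 \<le> K"
    using K[OF i[of 0]] norm_ge_zero order_trans by blast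

  \<comment> \<open>\<open>g k j\<close> is the \<open>j\<close>-th coordinate of the \<open>k\<close>-th block, and \<open>h\<close> enumerates all of them\<close>
  define g where "g k j x = (if j < length (fs k) then (1/2)^k * (fs k ! j) (P (i k) x) else 0)"
    for k j x
  define h where "h n = (case prod_decode n of (k, j) \<Rightarrow> g k j)" for n
  have g_linear: "linear (g k j)" for k j
  proof (cases "j < length (fs k)")
    case True
    then have "fs k ! j \<in> dual (E (i k)) norm"
      using fs[of k] by (auto simp: subset_iff)
    note lin = dual_linear[OF this range[OF i]]
    show ?thesis
      using True
      by (intro linearI)
        (simp_all add: g_def blinfun.add_right blinfun.scaleR_right lin(1) lin(2)[OF range[OF i]]
          distrib_left)
  qed (auto simp: g_def intro: linearI)
  have g_row: "(\<Sum>j<length (fs k). (g k j x)\<^sup>2) = (1/4)^k * (\<Sum>f\<leftarrow>fs k. (f (P (i k) x))\<^sup>2)" for k x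
  proof -
    have "((1/2::real)^k)\<^sup>2 = (1/4)^k"
      by (simp add: power2_eq_square flip: power_mult_distrib)
    then show ?thesis
      by (simp add: g_def power_mult_distrib sum_distrib_left sum_list_eq_sum_lessThan)
  qed
  have g_row_le: "(\<Sum>j<m. (g k j x)\<^sup>2) \<le> (1/4)^k * (K * norm x)\<^sup>2" for k m x
  proof -
    have "(\<Sum>j<m. (g k j x)\<^sup>2) = (\<Sum>j\<in>{..<m} \<inter> {..<length (fs k)}. (g k j x)\<^sup>2)"
      by (rule sum.mono_neutral_right) (auto simp: g_def)
    also have "\<dots> \<le> (\<Sum>j<length (fs k). (g k j x)\<^sup>2)"
      by (rule sum_mono2) auto
    also have "\<dots> \<le> (1/4)^k * (norm (P (i k) x))\<^sup>2"
      unfolding g_row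
      using sum_squares_le_norm_squared[OF normed_space_on_norm[OF sub[OF i]] fs fs_le range[OF i]]
      by (intro mult_left_mono) auto
    also have "\<dots> \<le> (1/4)^k * (K * norm x)\<^sup>2"
    proof (intro mult_left_mono power_mono)
      show "norm (P (i k) x) \<le> K * norm x"
        using norm_blinfun[of "P (i k)" x] mult_right_mono[OF K[OF i], of "norm x" k] by simp
    qed auto
    finally show ?thesis .
  qed
  have h_le: "(\<Sum>n<m. (h n x)\<^sup>2) \<le> (2 * K * norm x)\<^sup>2" for m x
  proof -
    have "(\<Sum>n<m. (h n x)\<^sup>2) = (\<Sum>(k, j)\<in>prod_decode ` {..<m}. (g k j x)\<^sup>2)"
      by (subst sum.reindex) (auto simp: h_def inj_prod_decode case_prod_beta)
    also have "\<dots> \<le> (\<Sum>(k, j)\<in>{..<m} \<times> {..<m}. (g k j x)\<^sup>2)"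
    proof (rule sum_mono2)
      show "prod_decode ` {..<m} \<subseteq> {..<m} \<times> {..<m}"
      proof
        fix p assume "p \<in> prod_decode ` {..<m}"
        then have "prod_encode p < m" by auto
        then show "p \<in> {..<m} \<times> {..<m}"
          using le_prod_encode_1[of "fst p" "snd p"] le_prod_encode_2[of "snd p" "fst p"]
          by (cases p) auto
      qed
    qed auto
    also have "\<dots> = (\<Sum>k<m. \<Sum>j<m. (g k j x)\<^sup>2)"
      by (simp add: sum.cartesian_product)
    also have "\<dots> \<le> (\<Sum>k<m. (1/4)^k * (K * norm x)\<^sup>2)"
      by (intro sum_mono g_row_le)
    also have "\<dots> \<le> 4 * (K * norm x)\<^sup>2"
      unfolding sum_distrib_right[symmetric]
      by (intro mult_right_mono sum_quarter_powers_le) simp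
    finally show ?thesis
      by (simp add: power_mult_distrib)
  qed
  have h_linear: "linear (h n)" for n
    by (simp add: h_def g_linear split: prod.split)
  obtain v where v: "bounded_linear v" "\<And>x n. ell2_nth (v x) n = h n x"
    using operator_into_ell2[OF h_linear _ h_le] K0 by auto
  have v_ge: "(1/4)^k * (\<Sum>f\<leftarrow>fs k. (f x)\<^sup>2) \<le> (norm (v x))\<^sup>2" if "x \<in> E (i k)" for k x
  proof -
    let ?A = "(\<lambda>j. prod_encode (k, j)) ` {..<length (fs k)}"
    have "(1/4)^k * (\<Sum>f\<leftarrow>fs k. (f x)\<^sup>2) = (\<Sum>j<length (fs k). (g k j x)\<^sup>2)"
      using that by (simp add: g_row proj[OF i])
    also have "\<dots> = (\<Sum>n\<in>?A. (ell2_nth (v x) n)\<^sup>2)"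
      by (subst sum.reindex) (auto simp: v(2) h_def inj_on_def)
    also have "\<dots> \<le> (norm (v x))\<^sup>2"
      by (rule sum_squares_le_norm_ell2) simp
    finally show ?thesis .
  qed

  have "two_summing v"
    using HS v(1) by (simp add: hilbert_schmidt_space_def)
  then obtain C where C: "\<And>(n::nat) (x :: nat \<Rightarrow> 'a).
        sqrt (\<Sum>i<n. (norm (v (x i)))\<^sup>2)
          \<le> C * sqrt (SUP f \<in> {f :: 'a \<Rightarrow>\<^sub>L real. norm f \<le> 1}. \<Sum>i<n. (blinfun_apply f (x i))\<^sup>2)"
    unfolding two_summing_def by blast
  have "2^k \<le> C\<^sup>2" for k
  proof -
    let ?n = "length (xs k)" and ?x = "\<lambda>j. xs k ! j"
    let ?W = "SUP f \<in> {f :: 'a \<Rightarrow>\<^sub>L real. norm f \<le> 1}. \<Sum>i<?n. (blinfun_apply f (?x i))\<^sup>2"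
    have "?W \<le> 1"
    proof (rule cSUP_least)
      show "{f :: 'a \<Rightarrow>\<^sub>L real. norm f \<le> 1} \<noteq> {}"
        by (auto intro: exI[of _ 0])
      fix \<phi> :: "'a \<Rightarrow>\<^sub>L real" assume "\<phi> \<in> {f. norm f \<le> 1}"
      then have "(\<lambda>x. if x \<in> E (i k) then \<phi> x else 0) \<in> dual_ball (E (i k)) norm"
        by (intro restrict_blinfun_in_dual_ball sub i) simp
      from xs_le[OF this] show "(\<Sum>j<?n. (\<phi> (?x j))\<^sup>2) \<le> 1"
        using xs[of k] by (simp add: sum_list_eq_sum_lessThan subset_iff)
    qed
    have "0 \<le> ?W"
      using sum_squares_le_weak_norm[of 0 ?x "{..<?n}"] by simp
    then have "C * sqrt ?W \<le> \<bar>C\<bar> * 1"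
      using \<open>?W \<le> 1\<close> by (intro mult_mono) auto
    with C[of ?x ?n] have "sqrt (\<Sum>j<?n. (norm (v (?x j)))\<^sup>2) \<le> \<bar>C\<bar>"
      by linarith
    then have "(\<Sum>j<?n. (norm (v (?x j)))\<^sup>2) \<le> C\<^sup>2"
      using sqrt_le_D by fastforce
    have "(2::real)^k = (1/4)^k * 8^k"
      by (simp add: power_mult_distrib[symmetric])
    also have "\<dots> \<le> (1/4)^k * (\<Sum>f\<leftarrow>fs k. \<Sum>x\<leftarrow>xs k. (f x)\<^sup>2)"
      using large[of k] by (intro mult_left_mono) auto
    also have "(\<Sum>f\<leftarrow>fs k. \<Sum>x\<leftarrow>xs k. (f x)\<^sup>2) = (\<Sum>x\<leftarrow>xs k. \<Sum>f\<leftarrow>fs k. (f x)\<^sup>2)"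
      unfolding sum_list_eq_sum_lessThan by (rule sum.swap)
    also have "(1/4)^k * \<dots> = (\<Sum>x\<leftarrow>xs k. (1/4)^k * (\<Sum>f\<leftarrow>fs k. (f x)\<^sup>2))"
      by (simp add: sum_list_const_mult)
    also have "\<dots> \<le> (\<Sum>x\<leftarrow>xs k. (norm (v x))\<^sup>2)"
      using xs[of k] by (intro sum_list_mono v_ge) auto
    also have "\<dots> \<le> C\<^sup>2"
      using \<open>(\<Sum>j<?n. (norm (v (?x j)))\<^sup>2) \<le> C\<^sup>2\<close> by (simp add: sum_list_eq_sum_lessThan)
    finally show ?thesis .
  qed
  moreover obtain k where "C\<^sup>2 < 2^k"
    using real_arch_pow[of 2 "C\<^sup>2"] by auto
  ultimately show False
    by (meson not_le)
qed

section \<open>Spaces approximated by subspaces with bounded \<open>\<gamma>\<close>\<close>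

text \<open>
  For fixed \<open>N\<close> and \<open>m\<close>, the first \<open>m\<close> coordinates of \<open>u\<close> restricted to \<open>E N\<close> form a finite system
  of functionals, to which the bound on \<open>\<gamma>\<close> applies.  The resulting estimate depends neither on
  \<open>m\<close> nor on \<open>N\<close> and survives both limits.
\<close>

lemma two_summing_if_gamma_const_bounded:
  fixes E :: "nat \<Rightarrow> 'a::banach set" and P :: "nat \<Rightarrow> 'a \<Rightarrow>\<^sub>L 'a"
  assumes sub: "\<And>n. subspace (E n)"
    and range: "\<And>n x. P n x \<in> E n"
    and K: "\<And>n. norm (P n) \<le> K"
    and approx: "\<And>x. (\<lambda>n. P n x) \<longlonglongrightarrow> x"
    and c: "0 \<le> c" "\<And>n. gamma_const (E n) norm < ereal c"
    and u: "bounded_linear (u :: 'a \<Rightarrow> ell2)"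
  shows "two_summing u"
proof -
  \<comment> \<open>a positive bound, so that functionals can be divided by it\<close>
  define M where "M = max K 1"
  have M: "0 < M" "\<And>n. norm (P n) \<le> M"
    using K by (auto simp: M_def intro: order_trans[OF _ max.cobounded1])
  obtain L where L: "0 \<le> L" "\<And>x. norm (u x) \<le> norm x * L"
    using bounded_linear.nonneg_bounded[OF u] by blast
  interpret u: bounded_linear u by (rule u)
  have coord: "\<bar>ell2_nth y j\<bar> \<le> norm y" for y j
    using sum_squares_le_norm_ell2[of "{j}" y] by (simp add: abs_le_square_iff[symmetric])
  have main: "sqrt (\<Sum>i<n. (norm (u (x i)))\<^sup>2)
      \<le> (sqrt c * M * L) * sqrt (SUP f \<in> {f :: 'a \<Rightarrow>\<^sub>L real. norm f \<le> 1}. \<Sum>i<n. (blinfun_apply f (x i))\<^sup>2)"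
    for n and x :: "nat \<Rightarrow> 'a"
  proof -
    define W where "W = (SUP f \<in> {f :: 'a \<Rightarrow>\<^sub>L real. norm f \<le> 1}. \<Sum>i<n. (blinfun_apply f (x i))\<^sup>2)"
    have W: "(\<Sum>i<n. (f (x i))\<^sup>2) \<le> W" if "norm f \<le> 1" for f :: "'a \<Rightarrow>\<^sub>L real"
      unfolding W_def by (rule sum_squares_le_weak_norm[OF that])
    have finite_rank: "(\<Sum>i<n. \<Sum>j<m. (ell2_nth (u (P N (x i))) j)\<^sup>2) \<le> c * (M\<^sup>2 * W) * L\<^sup>2" for N m
    proof -
      define F where "F j y = (if y \<in> E N then ell2_nth (u y) j else 0)" for j y
      let ?xs = "map (\<lambda>i. P N (x i)) [0..<n]" and ?fs = "map F [0..<m]"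
      have "(\<Sum>f\<leftarrow>?fs. \<Sum>y\<leftarrow>?xs. (f y)\<^sup>2) \<le> c * (M\<^sup>2 * W) * L\<^sup>2"
      proof (rule sum_squares_le_of_gamma_const_less[OF normed_space_on_norm[OF sub[of N]] c])
        show "set ?xs \<subseteq> E N"
          using range by auto
        have "F j \<in> dual (E N) norm" for j
        proof -
          have "linear_on (E N) (F j)"
            using subspace_add[OF sub] subspace_scale[OF sub]
            by (simp add: linear_on_def F_def u.add u.scaleR ell2_nth_add ell2_nth_scaleR)
          moreover have "\<forall>y\<in>E N. \<bar>F j y\<bar> \<le> L * norm y"
            using order_trans[OF coord L(2)] by (simp add: F_def mult.commute)
          ultimately show ?thesis
            unfolding dual_def by (auto simp: F_def)
        qed
        then show "set ?fs \<subseteq> dual (E N) norm"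
          by auto
      next
        fix f assume f: "f \<in> dual_ball (E N) norm"
        then have fD: "f \<in> dual (E N) norm" by (simp add: dual_ball_def)
        have le: "norm (f (P N y) / M) \<le> norm y * 1" for y
        proof -
          have "\<bar>f (P N y)\<bar> \<le> norm (P N y)"
            by (rule abs_le_norm_of_dual_ball[OF normed_space_on_norm[OF sub] f range])
          also have "\<dots> \<le> M * norm y"
            using norm_blinfun[of "P N" y] mult_right_mono[OF M(2), of "norm y" N] by simp
          finally show ?thesis
            using M(1) by (simp add: field_simps)
        qed
        \<comment> \<open>the projection extends \<open>f\<close> to the whole space, at the cost of the factor \<open>M\<close>\<close>
        have bl: "bounded_linear (\<lambda>y. f (P N y) / M)"
          by (rule bounded_linear_intro[OF _ _ le])
            (simp_all add: blinfun.add_right blinfun.scaleR_right dual_linear(1)[OF fD range]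
              dual_linear(2)[OF fD range range] add_divide_distrib)
        have "norm (Blinfun (\<lambda>y. f (P N y) / M)) \<le> 1"
          using le by (intro norm_blinfun_bound) (simp_all add: bounded_linear_Blinfun_apply[OF bl])
        from W[OF this] have "(\<Sum>i<n. (f (P N (x i)))\<^sup>2 / M\<^sup>2) \<le> W"
          by (simp add: bounded_linear_Blinfun_apply[OF bl] power_divide)
        then have "(\<Sum>i<n. (f (P N (x i)))\<^sup>2) \<le> M\<^sup>2 * W"
          using M(1) by (simp add: sum_divide_distrib[symmetric] field_simps)
        then show "(\<Sum>y\<leftarrow>?xs. (f y)\<^sup>2) \<le> M\<^sup>2 * W"
          by (simp add: sum_list_eq_sum_lessThan)
      next
        fix y assume y: "y \<in> E N" "norm y \<le> 1"
        have "(\<Sum>j<m. (ell2_nth (u y) j)\<^sup>2) \<le> (norm (u y))\<^sup>2"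
          by (rule sum_squares_le_norm_ell2) simp
        also have "\<dots> \<le> L\<^sup>2"
        proof (rule power_mono)
          show "norm (u y) \<le> L"
            using L(2)[of y] mult_right_mono[OF y(2) L(1)] by simp
        qed simp
        finally show "(\<Sum>f\<leftarrow>?fs. (f y)\<^sup>2) \<le> L\<^sup>2"
          using y by (simp add: sum_list_eq_sum_lessThan F_def)
      qed
      then have "(\<Sum>j<m. \<Sum>i<n. (ell2_nth (u (P N (x i))) j)\<^sup>2) \<le> c * (M\<^sup>2 * W) * L\<^sup>2"
        by (simp add: sum_list_eq_sum_lessThan F_def range)
      then show ?thesis
        by (subst sum.swap)
    qed
    have "(\<Sum>i<n. (norm (u (P N (x i))))\<^sup>2) \<le> c * (M\<^sup>2 * W) * L\<^sup>2" for N
    proof (rule LIMSEQ_le_const2)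
      show "(\<lambda>m. \<Sum>i<n. \<Sum>j<m. (ell2_nth (u (P N (x i))) j)\<^sup>2)
          \<longlonglongrightarrow> (\<Sum>i<n. (norm (u (P N (x i))))\<^sup>2)"
        unfolding norm_ell2_squared by (intro tendsto_sum summable_LIMSEQ summable_ell2)
    qed (use finite_rank in blast)
    moreover have "(\<lambda>N. \<Sum>i<n. (norm (u (P N (x i))))\<^sup>2) \<longlonglongrightarrow> (\<Sum>i<n. (norm (u (x i)))\<^sup>2)"
      by (intro tendsto_sum tendsto_power tendsto_norm u.tendsto approx)
    ultimately have "(\<Sum>i<n. (norm (u (x i)))\<^sup>2) \<le> c * (M\<^sup>2 * W) * L\<^sup>2"
      by (intro LIMSEQ_le_const2) auto
    then have "sqrt (\<Sum>i<n. (norm (u (x i)))\<^sup>2) \<le> sqrt (c * (M\<^sup>2 * W) * L\<^sup>2)"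
      by (rule real_sqrt_le_mono)
    also have "\<dots> = (sqrt c * M * L) * sqrt W"
      using M(1) L(1) by (simp add: real_sqrt_mult)
    finally show ?thesis unfolding W_def .
  qed
  show ?thesis
    unfolding two_summing_def
    using main bounded_linear.linear[OF u] by blast
qed

text \<open>
  The projections eventually fix each point of the dense union, and uniform boundedness carries the
  convergence over to the closure.
\<close>

lemma bounded_projections_tendsto:
  fixes E :: "nat \<Rightarrow> 'a::banach set" and P :: "nat \<Rightarrow> 'a \<Rightarrow>\<^sub>L 'a"
  assumes increasing: "\<And>n. E n \<subseteq> E (Suc n)"
    and dense: "closure (\<Union>n. E n) = UNIV"
    and proj: "\<And>n x. x \<in> E n \<Longrightarrow> P n x = x"
    and K: "\<And>n. norm (P n) \<le> K"
  shows "(\<lambda>n. P n x) \<longlonglongrightarrow> x"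
proof (rule LIMSEQ_I)
  fix r :: real assume r: "0 < r"
  have K0: "0 \<le> K"
    using K[of 0] norm_ge_zero order_trans by blast
  have "x \<in> closure (\<Union>n. E n)"
    using dense by simp
  then obtain y where y: "y \<in> (\<Union>n. E n)" "dist y x < r / (K + 1)"
    using r K0 unfolding closure_approachable by (meson add_nonneg_pos divide_pos_pos zero_less_one)
  then obtain m where m: "y \<in> E m" by blast
  have "norm (P n x - x) < r" if "m \<le> n" for n
  proof -
    have "y \<in> E n"
      using m that lift_Suc_mono_le[of E, OF increasing] by blast
    then have "P n x - x = P n (x - y) + (y - x)"
      by (simp add: blinfun.diff_right proj)
    then have "norm (P n x - x) \<le> norm (P n (x - y)) + norm (y - x)"
      by (metis norm_triangle_ineq)
    also have "\<dots> \<le> K * norm (y - x) + norm (y - x)"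
      using norm_blinfun[of "P n" "x - y"] mult_right_mono[OF K, of "norm (x - y)" n]
      by (simp add: norm_minus_commute)
    also have "\<dots> < r"
      using y(2) K0 by (simp add: dist_norm field_simps)
    finally show ?thesis .
  qed
  then show "\<exists>m. \<forall>n\<ge>m. norm (P n x - x) < r" by blast
qed

section \<open>The characterisation\<close>

theorem proposition5p5:
  fixes E :: "nat \<Rightarrow> 'a::banach set"
    and P :: "nat \<Rightarrow> 'a \<Rightarrow>\<^sub>L 'a"
  assumes subspaces: "\<And>n. n \<ge> 1 \<Longrightarrow> subspace (E n)"
    and dims: "\<And>n. n \<ge> 1 \<Longrightarrow> dim (E n) = n"
    and increasing: "\<And>n. n \<ge> 1 \<Longrightarrow> E n \<subseteq> E (Suc n)"
    and dense: "closure (\<Union>n\<in>{1..}. E n) = UNIV"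
    and projections: "\<And>n. n \<ge> 1 \<Longrightarrow>
          range (blinfun_apply (P n)) \<subseteq> E n \<and> (\<forall>x\<in>E n. blinfun_apply (P n) x = x)"
    and bounded: "bdd_above ((\<lambda>n. norm (P n)) ` {1..})"
  shows "little_GT_flag E (\<lambda>n. norm) (\<lambda>n x. x) \<longleftrightarrow> hilbert_schmidt_space TYPE('a)"
proof -
  obtain K where K: "\<And>n. n \<ge> 1 \<Longrightarrow> norm (P n) \<le> K"
    using bounded by (auto simp: bdd_above_def)
  have P: "P n x \<in> E n" "x \<in> E n \<Longrightarrow> P n x = x" if "n \<ge> 1" for n x
    using projections[OF that] by auto
  have "isometry_on (E n) norm (E (Suc n)) norm (\<lambda>x. x)" if "n \<ge> 1" for n
    using increasing[OF that] by (auto simp: isometry_on_def linear_on_def)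
  then have flag_iff: "little_GT_flag E (\<lambda>n. norm) (\<lambda>n x. x)
      \<longleftrightarrow> (SUP n\<in>{1..}. gamma_const (E n) norm) < \<infinity>"
    using normed_space_on_norm subspaces dims by (auto simp: little_GT_flag_def)
  show ?thesis
    unfolding flag_iff
  proof
    assume "(SUP n\<in>{1..}. gamma_const (E n) norm) < \<infinity>"
    then obtain c :: nat where c: "(SUP n\<in>{1..}. gamma_const (E n) norm) < ereal (real c)"
      unfolding less_PInf_Ex_of_nat[symmetric] by (auto simp: less_PInf_Ex_of_nat)
    \<comment> \<open>the index is shifted, since nothing is known about \<open>E 0\<close> and \<open>P 0\<close>\<close>
    have tail: "(\<Union>n. E (Suc n)) = (\<Union>n\<in>{1..}. E n)"
      by (auto simp: Bex_def) (metis Suc_le_D)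
    have gamma: "gamma_const (E (Suc n)) norm < ereal (real c)" for n
      by (rule le_less_trans[OF SUP_upper c]) simp
    have approx: "(\<lambda>n. P (Suc n) x) \<longlonglongrightarrow> x" for x
      by (rule bounded_projections_tendsto[of "\<lambda>n. E (Suc n)" _ K])
        (use increasing dense tail P K in auto)
    show "hilbert_schmidt_space TYPE('a)"
      unfolding hilbert_schmidt_space_def
    proof (intro allI impI)
      fix u :: "'a \<Rightarrow> ell2" assume u: "bounded_linear u"
      show "two_summing u"
        by (rule two_summing_if_gamma_const_bounded
            [of "\<lambda>n. E (Suc n)" "\<lambda>n. P (Suc n)" K, OF _ _ _ approx _ gamma u])
          (use subspaces P K in auto)
    qed
  next
    assume "hilbert_schmidt_space TYPE('a)"
    then have "\<exists>c::real. \<forall>n\<in>{1..}. gamma_const (E n) norm \<le> ereal c"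
      by (rule gamma_const_bounded_if_hilbert_schmidt_space[where P = P and K = K])
        (use subspaces P K in auto)
    then obtain c :: real where "\<forall>n\<in>{1..}. gamma_const (E n) norm \<le> ereal c"
      by blast
    then have "(SUP n\<in>{1..}. gamma_const (E n) norm) \<le> ereal c"
      by (intro SUP_least) blast
    then show "(SUP n\<in>{1..}. gamma_const (E n) norm) < \<infinity>"
      using le_less_trans by fastforce
  qed
qed

end
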